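(* Let $K$ be a fixed finite set of integers $\geqslant 2$ with $\{2,3\}\subseteq K$, let $l$ be the maximal element of $K$, and for each $n$ let $\mathcal A$ be a maximal $K$-antichain of minimum size on $n$ points (i.e. of smallest cardinality among all maximal $K$-antichains in $2^{[n]}$). Then, as $n\to\infty$, \[\lvert\mathcal A\rvert=\left(\frac{\lfloor l/2\rfloor\lceil l/2\rceil+1}{4\lfloor l/2\rfloor\lceil l/2\rceil}+o(1)\right)n^2.\]
   Context: Let $[n]=\{1,\dots,n\}$, with $n$ large enough that $K\subseteq[n]$. A family $\mathcal A\subseteq 2^{[n]}$ is an antichain if $A\not\subseteq B$ for all distinct $A,B\in\mathcal A$. It is a $K$-antichain if moreover $|A|\in K$ for all $A\in\mathcal A$. A $K$-antichain $\mathcal A$ is a maximal $K$-antichain if there is no $K$-antichain $\mathcal A'\subseteq 2^{[n]}$ with $\mathcal A\subsetneq\mathcal A'$. The $o(1)$ term depends only on $n$ and $K$ and tends to $0$ as $n\to\infty$. *)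

theory Defs
  imports Complex_Main
begin

definition antichain :: "nat \<Rightarrow> nat set set \<Rightarrow> bool" where
  "antichain n \<A> \<longleftrightarrow>
     \<A> \<subseteq> Pow {1..n} \<and> (\<forall>A\<in>\<A>. \<forall>B\<in>\<A>. A \<noteq> B \<longrightarrow> \<not> A \<subseteq> B)"

definition K_antichain :: "nat \<Rightarrow> nat set \<Rightarrow> nat set set \<Rightarrow> bool" where
  "K_antichain n K \<A> \<longleftrightarrow> antichain n \<A> \<and> (\<forall>A\<in>\<A>. card A \<in> K)"

definition maximal_K_antichain :: "nat \<Rightarrow> nat set \<Rightarrow> nat set set \<Rightarrow> bool" where
  "maximal_K_antichain n K \<A> \<longleftrightarrow>
     K_antichain n K \<A> \<and> \<not> (\<exists>\<A>'. K_antichain n K \<A>' \<and> \<A> \<subset> \<A>')"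

definition minimum_maximal_K_antichain :: "nat \<Rightarrow> nat set \<Rightarrow> nat set set \<Rightarrow> bool" where
  "minimum_maximal_K_antichain n K \<A> \<longleftrightarrow>
     maximal_K_antichain n K \<A> \<and>
     (\<forall>\<B>. maximal_K_antichain n K \<B> \<longrightarrow> card \<A> \<le> card \<B>)"

end

theory Submission
  imports Defs
begin

text \<open>
  Let \<open>G\<close> be the graph of pairs outside a maximal \<open>K\<close>-antichain \<open>\<A>\<close>. By maximality every edge and,
  as \<open>3 \<in> K\<close>, every triangle of \<open>G\<close> lies in a member of \<open>\<A>\<close> with at least three elements. If there
  are \<open>O(n\<^sup>2)\<close> such members, then \<open>G\<close> has \<open>O(n\<^sup>2)\<close> triangles, so all but boundedly many vertices have
  \<open>o(n\<^sup>2)\<close> edges in their neighbourhood. Let \<open>N\<close> be the neighbourhood of such a vertex of maximum degree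
  \<open>\<Delta>\<close>. Summing degrees over the complement of \<open>N\<close>, as in Fueredi's proof of stability for Mantel's
  theorem, bounds the number of edges not crossing between \<open>N\<close> and its complement by
  \<open>\<Delta>(n - \<Delta>) - e(G) + o(n\<^sup>2) \<le> n\<^sup>2/4 - e(G) + o(n\<^sup>2)\<close>. Each member of \<open>\<A>\<close> contains at most
  \<open>\<lfloor>l/2\<rfloor>\<lceil>l/2\<rceil>\<close> crossing pairs, which gives the lower bound without the triangle removal lemma.

  For the upper bound, split the points into two halves, cut these into blocks of sizes
  \<open>\<lfloor>l/2\<rfloor>\<close> and \<open>\<lceil>l/2\<rceil>\<close>, and take all unions of a block from each half together with the pairs
  contained in no such union.
\<close>

section \<open>Stability for graphs with few triangles\<close>

text \<open>Graphs are sets of ordered pairs: without loops, \<open>card R\<close> is twice the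
  number of edges, while a crossing edge counts once in
  \<open>R \<inter> (V - N) \<times> N\<close>. So the first bound limits the non-crossing edges.
  The second is Mantel's theorem with an error term; it caps the number of edges in the final
  optimization.\<close>

lemma bipartition_of_few_triangles:
  fixes V :: "'a set" and R :: "('a \<times> 'a) set" and D \<eta> :: real
  defines "n \<equiv> real (card V)"
  assumes V: "finite V" and RV: "R \<subseteq> V \<times> V" and "sym R"
    and tri: "real (card {(x, u, v). (x, u) \<in> R \<and> (x, v) \<in> R \<and> (u, v) \<in> R}) \<le> D * n\<^sup>2"
    and \<eta>: "\<eta> > 0" and D: "D \<ge> 0" and n: "n > D / \<eta>"
  obtains N where "N \<subseteq> V"
    and "real (card R) \<le> n\<^sup>2 / 4 + D / \<eta> * n + \<eta> * n\<^sup>2 + real (card (R \<inter> (V - N) \<times> N))"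
    and "real (card R) \<le> n\<^sup>2 / 2 + 2 * (D / \<eta> * n + \<eta> * n\<^sup>2)"
proof -
  define nb where "nb x = R `` {x}" for x
  define t where "t x = card (R \<inter> nb x \<times> nb x)" for x
  define B where "B = {x \<in> V. real (t x) > \<eta> * n\<^sup>2}"
  have finR: "finite R" using RV V finite_subset by blast
  have nbV: "nb x \<subseteq> V" for x using RV by (auto simp: nb_def)
  have fin_nb: "finite (nb x)" for x using nbV V finite_subset by blast
  have BV: "B \<subseteq> V" by (auto simp: B_def)
  have finB: "finite B" using BV V finite_subset by blast
  have npos: "n > 0" using n D \<eta> by (smt (verit) divide_nonneg_pos)
  \<comment> \<open>Ordered triangles are grouped by their first vertex. Since \<open>t\<close>
    exceeds \<open>\<eta> * n\<^sup>2\<close> on \<open>B\<close>, Markov's inequality leaves at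
    most \<open>D / \<eta>\<close> vertices in \<open>B\<close>, fewer than \<open>card V\<close> by
    the hypothesis on \<open>n\<close>.\<close>
  have "{(x, u, v). (x, u) \<in> R \<and> (x, v) \<in> R \<and> (u, v) \<in> R} = Sigma V (\<lambda>x. R \<inter> nb x \<times> nb x)"
    using RV by (auto simp: nb_def)
  then have "real (\<Sum>x\<in>V. t x) \<le> D * n\<^sup>2"
    using tri V finR by (simp add: card_SigmaI t_def)
  moreover have "real (\<Sum>x\<in>B. t x) \<le> real (\<Sum>x\<in>V. t x)"
    using V BV by (intro of_nat_mono sum_mono2) auto
  moreover have "real (card B) * (\<eta> * n\<^sup>2) \<le> (\<Sum>x\<in>B. real (t x))"
    by (rule sum_bounded_below) (auto simp: B_def)
  ultimately have "real (card B) * (\<eta> * n\<^sup>2) \<le> D * n\<^sup>2"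
    unfolding of_nat_sum by linarith
  then have "(real (card B) * \<eta>) * n\<^sup>2 \<le> D * n\<^sup>2"
    by (simp add: mult.assoc)
  then have "real (card B) * \<eta> \<le> D"
    using npos by simp
  then have cardB: "real (card B) \<le> D / \<eta>"
    using \<eta> by (simp add: field_simps)
  have "card B < card V" using cardB n n_def by linarith
  then have "V - B \<noteq> {}" using finB by (metis Diff_eq_empty_iff card_mono leD)
  moreover have "finite (V - B)" using V by simp
  ultimately have "Max ((\<lambda>y. card (nb y)) ` (V - B)) \<in> (\<lambda>y. card (nb y)) ` (V - B)"
    by (intro Max_in) auto
  \<comment> \<open>The maximum runs over \<open>V - B\<close> only, because \<open>x\<close> must
    lie outside \<open>B\<close> for \<open>N\<close> to span few edges. Vertices of
    \<open>B\<close> may have larger degree than \<open>x\<close>.\<close>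
  then obtain x where x: "x \<in> V - B" and "card (nb x) = Max ((\<lambda>y. card (nb y)) ` (V - B))"
    by auto
  then have max: "card (nb y) \<le> card (nb x)" if "y \<in> V - B" for y
    using that V by simp
  define N where "N = nb x"
  define C where "C = V - N"
  define \<Delta> where "\<Delta> = real (card N)"
  have NV: "N \<subseteq> V" and finN: "finite N" using nbV fin_nb by (auto simp: N_def)
  have finC: "finite C" using V by (simp add: C_def)
  have cardC: "real (card C) = n - \<Delta>"
    using NV V finN by (simp add: C_def \<Delta>_def n_def card_Diff_subset card_mono of_nat_diff)
  define F where "F = card (R \<inter> C \<times> N)"
  define rN where "rN = card (R \<inter> N \<times> N)"
  define rC where "rC = card (R \<inter> C \<times> C)"
  have F': "card (R \<inter> N \<times> C) = F"
  proof -
    have "R \<inter> N \<times> C = (R \<inter> C \<times> N)\<inverse>"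
      using \<open>sym R\<close> by (auto simp: sym_def)
    then show ?thesis by (simp add: F_def)
  qed
  \<comment> \<open>A crossing edge has one end in \<open>C\<close>, an edge inside \<open>C\<close>
    has two; the ordered counts \<open>F\<close> and \<open>rC\<close> record exactly this.\<close>
  have degsum: "(\<Sum>v\<in>C. card (nb v)) = F + rC"
  proof -
    have "(\<Sum>v\<in>C. card (nb v)) = card (Sigma C nb)"
      using finC fin_nb by (simp add: card_SigmaI)
    also have "Sigma C nb = (R \<inter> C \<times> N) \<union> (R \<inter> C \<times> C)"
      using RV NV by (auto simp: C_def nb_def)
    also have "card \<dots> = F + rC"
      unfolding F_def rC_def using finR by (intro card_Un_disjoint) (auto simp: C_def)
    finally show ?thesis .
  qed
  have cardR: "card R = rN + rC + 2 * F"
  proof -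
    have "R = (R \<inter> C \<times> N) \<union> (R \<inter> C \<times> C) \<union> ((R \<inter> N \<times> C) \<union> (R \<inter> N \<times> N))"
      using RV by (auto simp: C_def)
    also have "card \<dots> = card ((R \<inter> C \<times> N) \<union> (R \<inter> C \<times> C)) + card ((R \<inter> N \<times> C) \<union> (R \<inter> N \<times> N))"
      using finR by (intro card_Un_disjoint) (auto simp: C_def)
    also have "card ((R \<inter> C \<times> N) \<union> (R \<inter> C \<times> C)) = F + rC"
      unfolding F_def rC_def using finR by (intro card_Un_disjoint) (auto simp: C_def)
    also have "card ((R \<inter> N \<times> C) \<union> (R \<inter> N \<times> N)) = F + rN"
      unfolding F'[symmetric] rN_def using finR by (intro card_Un_disjoint) (auto simp: C_def)
    finally show ?thesis by simp
  qed
  \<comment> \<open>Outside \<open>B\<close> degrees are at most \<open>\<Delta>\<close> by the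
    choice of \<open>x\<close>. Each vertex of \<open>B\<close> is charged an extra
    \<open>n\<close>, enough for any degree.\<close>
  have "real (F + rC) \<le> (\<Sum>v\<in>C. \<Delta> + (if v \<in> B then n else 0))"
    unfolding degsum[symmetric] of_nat_sum
  proof (rule sum_mono)
    fix v assume "v \<in> C"
    then show "real (card (nb v)) \<le> \<Delta> + (if v \<in> B then n else 0)"
      using max[of v] card_mono[OF V nbV[of v]] by (auto simp: C_def \<Delta>_def n_def N_def)
  qed
  also have "\<dots> = (n - \<Delta>) * \<Delta> + real (card (C \<inter> B)) * n"
    using finC by (simp add: sum.distrib cardC sum.If_cases)
  also have "\<dots> \<le> n\<^sup>2 / 4 + D / \<eta> * n"
  proof -
    have "(n - \<Delta>) * \<Delta> \<le> n\<^sup>2 / 4"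
      using zero_le_power2[of "n - 2 * \<Delta>"] by (simp add: power2_eq_square algebra_simps)
    moreover have "real (card (C \<inter> B)) \<le> D / \<eta>"
      using cardB card_mono[OF finB Int_lower2, of C] by linarith
    ultimately show ?thesis
      using npos by (intro add_mono mult_right_mono) auto
  qed
  finally have 1: "real F + real rC \<le> n\<^sup>2 / 4 + D / \<eta> * n" by simp
  have 2: "real rN \<le> \<eta> * n\<^sup>2"
    using x by (auto simp: B_def t_def rN_def N_def not_less)
  show thesis
  proof
    show "N \<subseteq> V" by (rule NV)
    show "real (card R) \<le> n\<^sup>2 / 4 + D / \<eta> * n + \<eta> * n\<^sup>2 + real (card (R \<inter> (V - N) \<times> N))"
      using 1 2 by (simp add: cardR F_def C_def)
    show "real (card R) \<le> n\<^sup>2 / 2 + 2 * (D / \<eta> * n + \<eta> * n\<^sup>2)"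
      using 1 2 unfolding cardR by simp
  qed
qed

section \<open>Maximality criterion and lower bound\<close>

text \<open>Any proper extension of an antichain contains an extension by a single set, so it is
  enough to test one new set \<open>S\<close> at a time.\<close>

lemma maximal_K_antichain_iff:
  "maximal_K_antichain n K \<A> \<longleftrightarrow> K_antichain n K \<A> \<and>
     (\<forall>S. S \<subseteq> {1..n} \<longrightarrow> card S \<in> K \<longrightarrow> (\<exists>A\<in>\<A>. S \<subseteq> A \<or> A \<subseteq> S))"
proof (intro iffI conjI allI impI)
  fix S assume max: "maximal_K_antichain n K \<A>" and S: "S \<subseteq> {1..n}" "card S \<in> K"
  show "\<exists>A\<in>\<A>. S \<subseteq> A \<or> A \<subseteq> S"
  proof (rule ccontr)
    assume *: "\<not> (\<exists>A\<in>\<A>. S \<subseteq> A \<or> A \<subseteq> S)"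
    then have "\<A> \<subset> insert S \<A>" by blast
    moreover have "K_antichain n K \<A>" using max by (simp add: maximal_K_antichain_def)
    then have "K_antichain n K (insert S \<A>)"
      using * S unfolding K_antichain_def antichain_def by simp
    ultimately show False using max unfolding maximal_K_antichain_def by blast
  qed
next
  assume *: "K_antichain n K \<A> \<and>
     (\<forall>S. S \<subseteq> {1..n} \<longrightarrow> card S \<in> K \<longrightarrow> (\<exists>A\<in>\<A>. S \<subseteq> A \<or> A \<subseteq> S))"
  have False if \<A>': "K_antichain n K \<A>'" "\<A> \<subset> \<A>'" for \<A>'
  proof -
    obtain S where S: "S \<in> \<A>'" "S \<notin> \<A>" using \<A>' by blast
    then have "S \<subseteq> {1..n}" "card S \<in> K"
      using \<A>'(1) unfolding K_antichain_def antichain_def by blast+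
    then obtain A where "A \<in> \<A>" "S \<subseteq> A \<or> A \<subseteq> S" using * by blast
    moreover have "A \<in> \<A>'" "A \<noteq> S" using \<open>A \<in> \<A>\<close> \<A>'(2) S(2) by auto
    ultimately show False using S(1) \<A>'(1) unfolding K_antichain_def antichain_def by metis
  qed
  then show "maximal_K_antichain n K \<A>" using * unfolding maximal_K_antichain_def by blast
qed (simp add: maximal_K_antichain_def)

text \<open>The balanced split maximizes the product. If the smaller factor \<open>x\<close> falls
  short of \<open>l div 2\<close> by \<open>d\<close>, the other is at most \<open>d + h\<close>,
  and \<open>x * d + x * h\<close> grows when the first \<open>x\<close> is replaced by
  \<open>h\<close>. This bounds the crossing pairs inside one member of the antichain.\<close>

lemma mult_le_halves:
  fixes x y l :: nat
  assumes "x + y \<le> l"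
  shows "x * y \<le> l div 2 * ((l + 1) div 2)"
proof -
  have *: "x * y \<le> l div 2 * ((l + 1) div 2)" if "x \<le> y" "x + y \<le> l" for x y
  proof -
    have "x \<le> l div 2" using that by linarith
    then obtain d where d: "l div 2 = x + d" using le_Suc_ex by blast
    define h where "h = (l + 1) div 2"
    have h: "h \<ge> l div 2" "l = l div 2 + h" by (auto simp: h_def)
    have "y \<le> d + h" using h d that by linarith
    then have "x * y \<le> x * d + x * h" by (metis mult_le_mono2 distrib_left)
    also have "x * d \<le> d * h" using h d by (simp add: mult.commute)
    finally have "x * y \<le> (x + d) * h" by (simp add: algebra_simps)
    then show ?thesis using d by (simp add: h_def)
  qed
  show ?thesis
    using *[of x y] *[of y x] assms by (cases "x \<le> y") (auto simp: mult.commute add.commute)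
qed

text \<open>Let \<open>r = card R\<close> and let \<open>h\<close> be the stability error. Counting
  ordered pairs gives \<open>card P\<close> at least (n^2 - n - r)/2, and covering the crossing
  pairs gives \<open>card Q\<close> at least (r - n^2/4 - h)/p. As p is at least 2, the sum of these
  bounds does not increase with r, so the worst case is Mantel's bound r = n^2/2 + 2h.\<close>

lemma maximal_K_antichain_card_ge:
  fixes K :: "nat set" and n l :: nat and \<eta> :: real
  defines "p \<equiv> real (l div 2 * ((l + 1) div 2))"
  assumes "finite K" and K2: "\<forall>k\<in>K. 2 \<le> k" and K23: "2 \<in> K" "3 \<in> K" and l: "l = Max K"
    and max: "maximal_K_antichain n K \<A>"
    and \<eta>: "\<eta> > 0" and n: "real n > real l ^ 3 / \<eta>"
  shows "real (card \<A>) \<ge> (p + 1) / (4 * p) * (real n)\<^sup>2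
           - (real l ^ 3 / \<eta> + 1) * real n - \<eta> * (real n)\<^sup>2"
proof -
  define V where "V = {1..n}"
  define P where "P = {A \<in> \<A>. card A = 2}"
  define Q where "Q = {A \<in> \<A>. card A \<noteq> 2}"
  define R where "R = {(u, v). u \<in> V \<and> v \<in> V \<and> u \<noteq> v \<and> {u, v} \<notin> \<A>}"
  define R' where "R' = {(u, v). u \<in> V \<and> v \<in> V \<and> u \<noteq> v \<and> {u, v} \<in> \<A>}"
  have AV: "\<And>A. A \<in> \<A> \<Longrightarrow> A \<subseteq> V" and AK: "\<And>A. A \<in> \<A> \<Longrightarrow> card A \<in> K"
    using max unfolding maximal_K_antichain_def K_antichain_def antichain_def V_def by auto
  have compar: "\<exists>A\<in>\<A>. S \<subseteq> A \<or> A \<subseteq> S" if "S \<subseteq> V" "card S \<in> K" for S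
    using max that unfolding maximal_K_antichain_iff V_def by blast
  have finV: "finite V" and cardV: "card V = n" by (auto simp: V_def)
  have "\<A> \<subseteq> Pow V" using AV by blast
  then have fin\<A>: "finite \<A>" using finV finite_subset by blast
  have finA: "finite A" if "A \<in> \<A>" for A using AV[OF that] finV finite_subset by blast
  have card_le: "card A \<le> l" if "A \<in> \<A>" for A
    using AK[OF that] l \<open>finite K\<close> by simp
  have l3: "l \<ge> 3" using K23 l \<open>finite K\<close> by simp
  have p2: "p \<ge> 2"
  proof -
    have "2 * 1 \<le> l div 2 * ((l + 1) div 2)" using l3 by (intro mult_le_halves) simp
    then show ?thesis unfolding p_def by linarith
  qed
  have fin: "finite P" "finite Q" using fin\<A> by (auto simp: P_def Q_def)
  have card\<A>: "card \<A> = card P + card Q"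
  proof -
    have "\<A> = P \<union> Q" "P \<inter> Q = {}" by (auto simp: P_def Q_def)
    then show ?thesis using fin card_Un_disjoint by metis
  qed
  have covered: "\<exists>A\<in>Q. {u, v} \<subseteq> A" if uv: "(u, v) \<in> R" for u v
  proof -
    have uv': "u \<in> V" "v \<in> V" "u \<noteq> v" "{u, v} \<notin> \<A>" using uv by (auto simp: R_def)
    have "card {u, v} = 2" "{u, v} \<subseteq> V" using uv' by auto
    then obtain A where A: "A \<in> \<A>" "{u, v} \<subseteq> A \<or> A \<subseteq> {u, v}"
      using compar[of "{u, v}"] K23 by metis
    have "A \<noteq> {u, v}" using A uv' by auto
    have "\<not> A \<subseteq> {u, v}"
    proof
      assume "A \<subseteq> {u, v}"
      then have "A \<subset> {u, v}" using \<open>A \<noteq> {u, v}\<close> by blast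
      then have "card A < card {u, v}" by (intro psubset_card_mono) auto
      then show False using K2 AK[OF A(1)] uv' by auto
    qed
    moreover have "card A \<noteq> 2"
      using A \<open>A \<noteq> {u, v}\<close> card_subset_eq[of A "{u, v}"] finA[OF A(1)] uv' calculation by auto
    ultimately show ?thesis using A by (auto simp: Q_def)
  qed
  have tri: "\<exists>A\<in>Q. {x, u, v} \<subseteq> A" if *: "(x, u) \<in> R" "(x, v) \<in> R" "(u, v) \<in> R" for x u v
  proof -
    have **: "x \<in> V" "u \<in> V" "v \<in> V" "x \<noteq> u" "x \<noteq> v" "u \<noteq> v"
      "{x, u} \<notin> \<A>" "{x, v} \<notin> \<A>" "{u, v} \<notin> \<A>" using * by (auto simp: R_def)
    then have c3: "card {x, u, v} = 3" "{x, u, v} \<subseteq> V" by auto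
    then obtain A where A: "A \<in> \<A>" "{x, u, v} \<subseteq> A \<or> A \<subseteq> {x, u, v}"
      using compar[of "{x, u, v}"] K23 by metis
    have "card A \<ge> 2" using AK[OF A(1)] K2 by auto
    have sub: "{x, u, v} \<subseteq> A"
    proof (rule ccontr)
      assume ns: "\<not> {x, u, v} \<subseteq> A"
      \<comment> \<open>A member inside the triple that misses one of its points still has two
        elements, so it is one of the three sides; but these are edges of \<open>R\<close> and hence
        not members.\<close>
      then have "A \<subseteq> {x, u} \<or> A \<subseteq> {x, v} \<or> A \<subseteq> {u, v}" using A by blast
      then have "A = {x, u} \<or> A = {x, v} \<or> A = {u, v}"
        using \<open>card A \<ge> 2\<close> ** card_seteq[of "{x, u}" A] card_seteq[of "{x, v}" A]
          card_seteq[of "{u, v}" A] by auto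
      then show False using A ** by auto
    qed
    then have "card A \<ge> 3" using c3 card_mono[OF finA[OF A(1)] sub] by simp
    then show ?thesis using A sub by (auto simp: Q_def)
  qed
  have cardR': "card R' \<le> 2 * card P"
  proof -
    have "R' \<subseteq> (\<Union>A\<in>P. {(u, v). u \<noteq> v \<and> A = {u, v}})" by (auto simp: R'_def P_def)
    moreover have *: "finite {(u, v). u \<noteq> v \<and> A = {u, v}} \<and> card {(u, v). u \<noteq> v \<and> A = {u, v}} \<le> 2"
      if A: "A \<in> P" for A
    proof -
      obtain a b where "A = {a, b}" "a \<noteq> b" using A unfolding P_def card_2_iff by blast
      then have "{(u, v). u \<noteq> v \<and> A = {u, v}} = {(a, b), (b, a)}" by (auto simp: doubleton_eq_iff)
      then show ?thesis using \<open>a \<noteq> b\<close> by simp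
    qed
    ultimately have "card R' \<le> card (\<Union>A\<in>P. {(u, v). u \<noteq> v \<and> A = {u, v}})"
      using fin by (intro card_mono) auto
    also have "\<dots> \<le> (\<Sum>A\<in>P. card {(u, v). u \<noteq> v \<and> A = {u, v}})"
      by (rule card_UN_le[OF fin(1)])
    also have "\<dots> \<le> (\<Sum>A\<in>P. 2)" by (rule sum_mono) (use * in blast)
    finally show ?thesis by simp
  qed
  have sizes: "n * n \<le> n + card R + card R'"
  proof -
    have eq: "V \<times> V = (\<lambda>v. (v, v)) ` V \<union> R \<union> R'" by (auto simp: R_def R'_def)
    have "n * n = card (V \<times> V)" by (simp add: card_cartesian_product cardV)
    also have "\<dots> \<le> card ((\<lambda>v. (v, v)) ` V) + card R + card R'"
      unfolding eq by (meson card_Un_le add_le_mono1 order_trans)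
    also have "card ((\<lambda>v. (v, v)) ` V) \<le> n" using card_image_le[OF finV] cardV by metis
    finally show ?thesis by simp
  qed
  have lower_P: "real (card P) \<ge> ((real n)\<^sup>2 - real n - real (card R)) / 2"
  proof -
    have "real (n * n) \<le> real (n + card R + 2 * card P)"
      using sizes cardR' by (intro of_nat_mono) linarith
    then show ?thesis by (simp add: power2_eq_square)
  qed
  have h_nonneg: "0 \<le> real l ^ 3 / \<eta> * real n" "0 \<le> \<eta> * (real n)\<^sup>2" using \<eta> by auto
  show ?thesis
  \<comment> \<open>For larger \<open>Q\<close> the claim is immediate, its leading coefficient
    being at most 1. Otherwise the members of \<open>Q\<close> contain at most
    \<open>l ^ 3 * n\<^sup>2\<close> ordered triples, which gives the triangle bound with
    \<open>D = l ^ 3\<close>.\<close>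
  proof (cases "card Q \<le> n\<^sup>2")
    case False
    then have "real (card \<A>) \<ge> (real n)\<^sup>2"
      unfolding card\<A> by (metis le_add2 nat_le_linear of_nat_le_iff of_nat_power order_trans)
    moreover have "(p + 1) / (4 * p) * (real n)\<^sup>2 \<le> 1 * (real n)\<^sup>2"
      using p2 by (intro mult_right_mono) (auto simp: field_simps)
    ultimately show ?thesis using h_nonneg unfolding distrib_right mult_1 by linarith
  next
    case True
    have QA: "finite A \<and> card A \<le> l" if "A \<in> Q" for A
      using that finA card_le by (auto simp: Q_def)
    let ?T = "{(x, u, v). (x, u) \<in> R \<and> (x, v) \<in> R \<and> (u, v) \<in> R}"
    have "?T \<subseteq> (\<Union>A\<in>Q. A \<times> A \<times> A)" using tri by fastforce
    then have "card ?T \<le> card (\<Union>A\<in>Q. A \<times> A \<times> A)"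
      using fin QA by (intro card_mono) auto
    also have "\<dots> \<le> (\<Sum>A\<in>Q. card (A \<times> A \<times> A))" by (rule card_UN_le[OF fin(2)])
    also have "\<dots> \<le> (\<Sum>A\<in>Q. l ^ 3)"
      using QA by (intro sum_mono) (auto simp: card_cartesian_product power3_eq_cube mult.assoc intro!: mult_le_mono)
    also have "\<dots> \<le> l ^ 3 * n\<^sup>2" using True by simp
    finally have "real (card ?T) \<le> real (l ^ 3 * n\<^sup>2)" by (rule of_nat_mono)
    then have T: "real (card ?T) \<le> real l ^ 3 * (real (card V))\<^sup>2" by (simp add: cardV)
    have RV: "R \<subseteq> V \<times> V" and "sym R" by (auto simp: R_def sym_def insert_commute)
    obtain N where N: "N \<subseteq> V"
      and N1: "real (card R) \<le> (real n)\<^sup>2 / 4 + real l ^ 3 / \<eta> * real n + \<eta> * (real n)\<^sup>2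
                 + real (card (R \<inter> (V - N) \<times> N))"
      and N2: "real (card R) \<le> (real n)\<^sup>2 / 2 + 2 * (real l ^ 3 / \<eta> * real n + \<eta> * (real n)\<^sup>2)"
      using bipartition_of_few_triangles[OF finV RV \<open>sym R\<close> T \<eta>] n cardV by auto
    \<comment> \<open>A member \<open>A\<close> of \<open>Q\<close> covers only the crossing pairs
      in \<open>(A - N) \<times> (A \<inter> N)\<close>, and these two parts have at most
      \<open>l\<close> points together.\<close>
    have "R \<inter> (V - N) \<times> N \<subseteq> (\<Union>A\<in>Q. (A - N) \<times> (A \<inter> N))" using covered by fastforce
    then have "card (R \<inter> (V - N) \<times> N) \<le> card (\<Union>A\<in>Q. (A - N) \<times> (A \<inter> N))"
      using fin QA by (intro card_mono) auto
    also have "\<dots> \<le> (\<Sum>A\<in>Q. card ((A - N) \<times> (A \<inter> N)))" by (rule card_UN_le[OF fin(2)])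
    also have "\<dots> \<le> (\<Sum>A\<in>Q. l div 2 * ((l + 1) div 2))"
    proof (rule sum_mono)
      fix A assume "A \<in> Q"
      then have "card (A - N) + card (A \<inter> N) \<le> l"
        using QA[of A] card_Int_Diff[of A N] by simp
      then show "card ((A - N) \<times> (A \<inter> N)) \<le> l div 2 * ((l + 1) div 2)"
        unfolding card_cartesian_product by (rule mult_le_halves)
    qed
    also have "\<dots> = card Q * (l div 2 * ((l + 1) div 2))" by simp
    finally have "real (card (R \<inter> (V - N) \<times> N)) \<le> real (card Q) * p"
      unfolding p_def of_nat_mult[symmetric] by (rule of_nat_mono)
    define h where "h = real l ^ 3 / \<eta> * real n + \<eta> * (real n)\<^sup>2"
    define r where "r = real (card R)"
    have "h \<ge> 0" using h_nonneg by (simp add: h_def)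
    have rQ: "r - (real n)\<^sup>2 / 4 - h \<le> real (card Q) * p"
      using N1 \<open>real (card (R \<inter> (V - N) \<times> N)) \<le> real (card Q) * p\<close> by (simp add: r_def h_def)
    have r_le: "r \<le> (real n)\<^sup>2 / 2 + 2 * h" using N2 by (simp add: r_def h_def)
    \<comment> \<open>Monotonicity in \<open>r\<close>, free of division: multiplied by
      \<open>p\<close>, the sum of the two bounds has slope \<open>1 - p / 2\<close> in
      \<open>r\<close>, so its excess over the value at the largest possible \<open>r\<close> is
      half of this product.\<close>
    have "((real n)\<^sup>2 / 2 + 2 * h - r) * (p - 2) \<ge> 0" using r_le p2 by simp
    then have "((real n)\<^sup>2 / 2 - r / 2) * p + (r - (real n)\<^sup>2 / 4 - h)
        \<ge> (p + 1) / 4 * (real n)\<^sup>2 - h * p + h"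
      by (simp add: field_simps)
    then have "((real n)\<^sup>2 / 2 - r / 2 + real (card Q)) * p \<ge> (p + 1) / 4 * (real n)\<^sup>2 - h * p"
      using rQ \<open>h \<ge> 0\<close> by (simp add: algebra_simps)
    then have "(real n)\<^sup>2 / 2 - r / 2 + real (card Q) \<ge> (p + 1) / (4 * p) * (real n)\<^sup>2 - h"
      using p2 by (simp add: field_simps)
    moreover have "real (card \<A>) \<ge> (real n)\<^sup>2 / 2 - r / 2 - real n / 2 + real (card Q)"
      unfolding card\<A> using lower_P by (simp add: r_def field_simps)
    ultimately show ?thesis by (simp add: h_def algebra_simps)
  qed
qed

section \<open>Construction of a small maximal antichain\<close>

text \<open>Consecutive blocks of length \<open>a\<close> starting after \<open>c\<close> are the
  fibres of a quotient map, so a point determines its block. The condition \<open>c < v\<close> is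
  kept because truncated subtraction sends every smaller \<open>v\<close> to quotient 0.\<close>

lemma mem_block_iff:
  fixes a c i v :: nat
  assumes "a > 0"
  shows "v \<in> {c + a * i<..c + a * i + a} \<longleftrightarrow> c < v \<and> (v - Suc c) div a = i"
proof
  assume "v \<in> {c + a * i<..c + a * i + a}"
  then show "c < v \<and> (v - Suc c) div a = i"
    by (auto intro!: div_nat_eqI)
next
  assume "c < v \<and> (v - Suc c) div a = i"
  moreover have "a * ((v - Suc c) div a) \<le> v - Suc c" "v - Suc c < a * ((v - Suc c) div a) + a"
    using dividend_less_times_div[OF assms] by (auto simp: add.commute)
  ultimately have "a * i \<le> v - Suc c" "v - Suc c < a * i + a" "c < v" by auto
  then show "v \<in> {c + a * i<..c + a * i + a}" by auto
qed

text \<open>With halves of size w there are at most w^2/p unions of blocks and at most w^2 pairs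
  inside the halves. As w is at most n/2, this gives the leading term; pairs meeting the leftover
  points add only O(n).\<close>

lemma small_maximal_K_antichain:
  fixes K :: "nat set" and n l :: nat
  defines "p \<equiv> real (l div 2 * ((l + 1) div 2))"
  assumes K2: "\<forall>k\<in>K. 2 \<le> k" and "2 \<in> K" "l \<in> K" "l \<ge> 3"
  obtains \<A> where "maximal_K_antichain n K \<A>"
    and "real (card \<A>) \<le> (p + 1) / (4 * p) * (real n)\<^sup>2 + 2 * p * real n"
proof -
  define a where "a = l div 2"
  define b where "b = (l + 1) div 2"
  \<comment> \<open>This makes the half size \<open>w\<close> a multiple of both block lengths and
    leaves fewer than \<open>2 * (a * b)\<close> points outside the two halves.\<close>
  define m where "m = n div (2 * (a * b))"
  define w where "w = a * b * m"
  define X where "X i = {0 + a * i<..0 + a * i + a}" for i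
  define Y where "Y j = {w + b * j<..w + b * j + b}" for j
  define F where "F = (\<lambda>(i, j). X i \<union> Y j) ` ({..<b * m} \<times> {..<a * m})"
  define P where "P = {e. e \<subseteq> {1..n} \<and> card e = 2 \<and> \<not> (\<exists>A\<in>F. e \<subseteq> A)}"
  have a: "a > 0" and b: "b > 0" and ab: "a + b = l"
    using \<open>l \<ge> 3\<close> by (auto simp: a_def b_def)
  have wn: "2 * w \<le> n"
    using times_div_less_eq_dividend[of "2 * (a * b)" n] by (simp add: w_def m_def mult.assoc)
  have X_iff: "v \<in> X i \<longleftrightarrow> 0 < v \<and> (v - Suc 0) div a = i" for v i
    unfolding X_def by (rule mem_block_iff[OF a])
  have Y_iff: "v \<in> Y j \<longleftrightarrow> w < v \<and> (v - Suc w) div b = j" for v j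
    unfolding Y_def by (rule mem_block_iff[OF b])
  have X_ex: "\<exists>i<b * m. v \<in> X i" if "v \<in> {1..w}" for v
  proof -
    have "v - Suc 0 < (b * m) * a" using that by (auto simp: w_def mult_ac)
    then show ?thesis using that less_mult_imp_div_less by (auto simp: X_iff)
  qed
  have Y_ex: "\<exists>j<a * m. v \<in> Y j" if "v \<in> {w<..2 * w}" for v
  proof -
    have "v - Suc w < w" using that by auto
    then have "v - Suc w < (a * m) * b" by (simp add: w_def mult_ac)
    then show ?thesis using that less_mult_imp_div_less by (auto simp: Y_iff)
  qed
  have XU: "X i \<subseteq> {1..w}" if "i < b * m" for i
  proof -
    have "a * Suc i \<le> a * (b * m)" using that by (intro mult_le_mono2) simp
    then show ?thesis by (auto simp: X_def w_def mult.assoc)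
  qed
  have YW: "Y j \<subseteq> {w<..2 * w}" if "j < a * m" for j
  proof -
    have "b * Suc j \<le> b * (a * m)" using that by (intro mult_le_mono2) simp
    then have "b * j + b \<le> w" by (simp add: w_def mult_ac)
    then show ?thesis by (auto simp: Y_def)
  qed
  have F_props: "A \<subseteq> {1..2 * w} \<and> card A = l" if A: "A \<in> F" for A
  proof -
    obtain i j where ij: "i < b * m" "j < a * m" "A = X i \<union> Y j" using A by (auto simp: F_def)
    have "{1..w} \<inter> {w<..2 * w} = {}" by auto
    then have "X i \<inter> Y j = {}" using XU[OF ij(1)] YW[OF ij(2)] by blast
    then have "card A = card (X i) + card (Y j)"
      unfolding ij by (intro card_Un_disjoint) (auto simp: X_def Y_def)
    then have "card A = l" using ab by (simp add: X_def Y_def)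
    moreover have "{1..w} \<union> {w<..2 * w} = {1..2 * w}" by auto
    ultimately show ?thesis using XU[OF ij(1)] YW[OF ij(2)] ij(3) by blast
  qed
  have F_I: "X i \<union> Y j \<in> F" if "i < b * m" "j < a * m" for i j
    using that by (auto simp: F_def)
  have anti: "K_antichain n K (F \<union> P)"
    unfolding K_antichain_def antichain_def
  proof (intro conjI ballI impI)
    show "F \<union> P \<subseteq> Pow {1..n}" using F_props wn by (fastforce simp: P_def)
    fix A assume A: "A \<in> F \<union> P"
    show "card A \<in> K" using A F_props \<open>2 \<in> K\<close> \<open>l \<in> K\<close> by (auto simp: P_def)
    fix B assume B: "B \<in> F \<union> P" and "A \<noteq> B"
    show "\<not> A \<subseteq> B"
    proof
      assume "A \<subseteq> B"
      have "card B > 0" using B F_props[of B] \<open>l \<ge> 3\<close> by (auto simp: P_def)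
      then have "finite B" by (rule card_ge_0_finite)
      \<comment> \<open>The only sizes are 2 and \<open>l\<close>, so a proper inclusion would put a
        pair of \<open>P\<close> inside a member of \<open>F\<close>, which the definition of
        \<open>P\<close> forbids.\<close>
      then have "card A < card B"
        using \<open>A \<subseteq> B\<close> \<open>A \<noteq> B\<close> by (intro psubset_card_mono) auto
      moreover have cards: "card A = 2 \<and> A \<in> P \<or> card A = l" "card B = 2 \<or> card B = l \<and> B \<in> F"
        using A B F_props[of A] F_props[of B] unfolding P_def by blast+
      ultimately have "A \<in> P" "B \<in> F" using \<open>l \<ge> 3\<close> by auto
      then show False using \<open>A \<subseteq> B\<close> unfolding P_def by blast
    qed
  qed
  \<comment> \<open>If \<open>S\<close> contains no pair of \<open>P\<close>, each of its pairs lies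
    in a union of two blocks. Then \<open>S\<close> avoids the leftover points, and two points of
    \<open>S\<close> in the same half share a block, since the block from the other half contains
    neither. Hence one union contains all of \<open>S\<close>.\<close>
  have "\<exists>A\<in>F \<union> P. S \<subseteq> A \<or> A \<subseteq> S" if S: "S \<subseteq> {1..n}" "card S \<in> K" for S
  proof (cases "\<exists>e\<in>P. e \<subseteq> S")
    case False
    have pair: "\<exists>i j. i < b * m \<and> j < a * m \<and> {u, v} \<subseteq> X i \<union> Y j" if "u \<in> S" "v \<in> S" "u \<noteq> v" for u v
    proof -
      have uv: "{u, v} \<subseteq> S" "card {u, v} = 2" using that by auto
      then have "{u, v} \<notin> P" using False by meson
      then have "\<exists>A\<in>F. {u, v} \<subseteq> A" using uv S(1) unfolding P_def by blast
      then show ?thesis by (auto simp: F_def)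
    qed
    have "2 \<le> card S" using S K2 by blast
    have other: "\<exists>v\<in>S. u \<noteq> v" if "u \<in> S" for u
    proof (rule ccontr)
      assume "\<not> (\<exists>v\<in>S. u \<noteq> v)"
      then have "v = u" if "v \<in> S" for v using that by metis
      then have "S \<subseteq> {u}" by (intro subsetI) simp
      then show False using \<open>2 \<le> card S\<close> card_mono[of "{u}" S] by simp
    qed
    have "S \<noteq> {}" using \<open>2 \<le> card S\<close> by auto
    \<comment> \<open>If \<open>S\<close> misses a half, any block there will do. That one exists is
      taken from a pair in \<open>S\<close>, since the index ranges are empty when
      \<open>m = 0\<close>.\<close>
    then obtain i0 j0 where ij0: "i0 < b * m" "j0 < a * m" using other pair by blast
    have SV: "u \<in> {1..2 * w}" if "u \<in> S" for u
    proof -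
      obtain v i j where "i < b * m" "j < a * m" "{u, v} \<subseteq> X i \<union> Y j" using other pair \<open>u \<in> S\<close> by metis
      then show ?thesis using F_I F_props by blast
    qed
    have X: "\<exists>i<b * m. S \<inter> {1..w} \<subseteq> X i"
    proof (cases "S \<inter> {1..w} = {}")
      case False
      then obtain u where u: "u \<in> S" "u \<in> {1..w}" by blast
      then obtain i where i: "i < b * m" "u \<in> X i" using X_ex by blast
      have "v \<in> X i" if v: "v \<in> S" "v \<in> {1..w}" for v
      proof (cases "u = v")
        case False
        then obtain i' j' where *: "i' < b * m" "j' < a * m" "{u, v} \<subseteq> X i' \<union> Y j'" using pair u v by metis
        then have "u \<in> X i'" "v \<in> X i'" using YW[of j'] u v by auto
        then show ?thesis using i by (simp add: X_iff)
      qed (use i in simp)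
      then show ?thesis using i by blast
    qed (use ij0 in blast)
    have Y: "\<exists>j<a * m. S \<inter> {w<..2 * w} \<subseteq> Y j"
    proof (cases "S \<inter> {w<..2 * w} = {}")
      case False
      then obtain u where u: "u \<in> S" "u \<in> {w<..2 * w}" by blast
      then obtain j where j: "j < a * m" "u \<in> Y j" using Y_ex by blast
      have "v \<in> Y j" if v: "v \<in> S" "v \<in> {w<..2 * w}" for v
      proof (cases "u = v")
        case False
        then obtain i' j' where *: "i' < b * m" "j' < a * m" "{u, v} \<subseteq> X i' \<union> Y j'" using pair u v by metis
        then have "u \<in> Y j'" "v \<in> Y j'" using XU[of i'] u v by auto
        then show ?thesis using j by (simp add: Y_iff)
      qed (use j in simp)
      then show ?thesis using j by blast
    qed (use ij0 in blast)
    obtain i j where ij: "i < b * m" "j < a * m"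
      and "S \<inter> {1..w} \<subseteq> X i" "S \<inter> {w<..2 * w} \<subseteq> Y j"
      using X Y by blast
    moreover have "S \<subseteq> (S \<inter> {1..w}) \<union> (S \<inter> {w<..2 * w})" using SV by auto
    ultimately have "S \<subseteq> X i \<union> Y j" by fast
    with F_I[OF ij] show ?thesis by (metis UnI1)
  qed blast
  then have max: "maximal_K_antichain n K (F \<union> P)"
    using anti by (simp add: maximal_K_antichain_iff)
  define Q where "Q k U = {e. e \<subseteq> U \<and> card e = k}" for k :: nat and U :: "nat set"
  \<comment> \<open>A pair with one point in each half lies in a member of \<open>F\<close>, so a
    pair of \<open>P\<close> stays within one half or meets the leftover points.\<close>
  have "P \<subseteq> Q 2 {1..w} \<union> Q 2 {w<..2 * w} \<union> (\<lambda>(u, v). {u, v}) ` ({2 * w<..n} \<times> {1..n})"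
  proof
    fix e assume e: "e \<in> P"
    then have "card e = 2" by (simp add: P_def)
    then obtain x y where "e = {x, y}" "x \<noteq> y" by (meson card_2_iff)
    then have "e = {min x y, max x y}" "min x y < max x y" by (auto simp: min_def max_def)
    then obtain u v where uv: "e = {u, v}" "u < v" by metis
    have uv1: "u \<in> {1..n}" "v \<in> {1..n}" using e uv by (auto simp: P_def)
    have nc: "\<not> (u \<in> {1..w} \<and> v \<in> {w<..2 * w})"
    proof
      assume "u \<in> {1..w} \<and> v \<in> {w<..2 * w}"
      then obtain i j where "i < b * m" "j < a * m" "u \<in> X i" "v \<in> Y j" using X_ex Y_ex by blast
      then have "X i \<union> Y j \<in> F" "e \<subseteq> X i \<union> Y j" using F_I uv by auto
      then show False using e by (auto simp: P_def)
    qed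
    show "e \<in> Q 2 {1..w} \<union> Q 2 {w<..2 * w} \<union> (\<lambda>(u, v). {u, v}) ` ({2 * w<..n} \<times> {1..n})"
    proof (cases "2 * w < v")
      case True
      then have "e = (\<lambda>(u, v). {u, v}) (v, u)" "(v, u) \<in> {2 * w<..n} \<times> {1..n}" using uv uv1 by auto
      then show ?thesis by blast
    next
      case False
      then have "e \<subseteq> {1..w} \<or> e \<subseteq> {w<..2 * w}" using uv uv1 nc by auto
      then show ?thesis using e by (auto simp: Q_def P_def)
    qed
  qed
  then have "card P \<le> card (Q 2 {1..w} \<union> Q 2 {w<..2 * w} \<union> (\<lambda>(u, v). {u, v}) ` ({2 * w<..n} \<times> {1..n}))"
    by (intro card_mono) (auto simp: Q_def)
  also have "\<dots> \<le> card (Q 2 {1..w}) + card (Q 2 {w<..2 * w}) + card ((\<lambda>(u, v). {u, v}) ` ({2 * w<..n} \<times> {1..n}))"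
    by (meson card_Un_le add_le_mono1 order_trans)
  also have "\<dots> \<le> w * w + 2 * (a * b) * n"
  proof (rule add_mono)
    have "2 * (w choose 2) \<le> w * (w - 1)" unfolding choose_two by (rule times_div_less_eq_dividend)
    also have "\<dots> \<le> w * w" by simp
    finally have "2 * (w choose 2) \<le> w * w" .
    then show "card (Q 2 {1..w}) + card (Q 2 {w<..2 * w}) \<le> w * w"
      by (simp add: Q_def n_subsets)
    have "n - 2 * w = n mod (2 * (a * b))"
      by (simp add: w_def m_def mult.assoc minus_mult_div_eq_mod[symmetric])
    then have "n - 2 * w \<le> 2 * (a * b)"
      using a b by (simp add: mod_less_divisor less_imp_le)
    then have "card ({2 * w<..n} \<times> {1..n}) \<le> 2 * (a * b) * n"
      by (simp add: card_cartesian_product)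
    then show "card ((\<lambda>(u, v). {u, v}) ` ({2 * w<..n} \<times> {1..n})) \<le> 2 * (a * b) * n"
      using card_image_le[of "{2 * w<..n} \<times> {1..n}" "\<lambda>(u, v). {u, v}"] by (meson finite_SigmaI finite_atLeastAtMost finite_greaterThanAtMost order_trans)
  qed
  finally have cardP: "card P \<le> w * w + 2 * (a * b) * n" .
  have cardF: "card F \<le> w * m"
    using card_image_le[of "{..<b * m} \<times> {..<a * m}" "\<lambda>(i, j). X i \<union> Y j"]
    by (simp add: F_def card_cartesian_product w_def mult_ac)
  have p: "p = real (a * b)" "p > 0" using a b by (auto simp: p_def a_def b_def)
  have "real (card (F \<union> P)) \<le> real (w * m + (w * w + 2 * (a * b) * n))"
    using card_Un_le[of F P] cardF cardP by (intro of_nat_mono) linarith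
  also have "\<dots> = real w * real m + (real w)\<^sup>2 + 2 * p * real n"
    by (simp add: p(1) power2_eq_square)
  \<comment> \<open>Since \<open>w\<close> is \<open>p\<close> times \<open>m\<close>, the bound
    \<open>w * m\<close> on \<open>card F\<close> equals w^2/p.\<close>
  also have "real w * real m + (real w)\<^sup>2 = (p + 1) / p * (real w)\<^sup>2"
  proof -
    have "real w = p * real m" by (simp add: w_def p(1))
    then show ?thesis using p(2) by (simp add: power2_eq_square field_simps)
  qed
  also have "(p + 1) / p * (real w)\<^sup>2 + 2 * p * real n \<le> (p + 1) / p * (real n / 2)\<^sup>2 + 2 * p * real n"
    using p(2) wn by (intro add_mono mult_left_mono power_mono) auto
  also have "\<dots> = (p + 1) / (4 * p) * (real n)\<^sup>2 + 2 * p * real n"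
    by (simp add: power2_eq_square)
  finally show thesis using max that by blast
qed

section \<open>Passage to the limit\<close>

theorem corollary7:
  fixes K :: "nat set" and l :: nat
  assumes "finite K"
    and "\<forall>k\<in>K. 2 \<le> k"
    and "{2, 3} \<subseteq> K"
    and "l = Max K"
  shows "\<exists>\<epsilon> :: nat \<Rightarrow> real. \<epsilon> \<longlonglongrightarrow> 0 \<and>
    (\<forall>n \<A>. K \<subseteq> {1..n} \<and> minimum_maximal_K_antichain n K \<A> \<longrightarrow>
       real (card \<A>) =
         ((real_of_int \<lfloor>real l / 2\<rfloor> * real_of_int \<lceil>real l / 2\<rceil> + 1)
            / (4 * real_of_int \<lfloor>real l / 2\<rfloor> * real_of_int \<lceil>real l / 2\<rceil>) + \<epsilon> n)
         * (real n)\<^sup>2)"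
proof -
  define p where "p = real (l div 2 * ((l + 1) div 2))"
  define \<kappa> where "\<kappa> = (p + 1) / (4 * p)"
  define min_ac where "min_ac n \<A> \<longleftrightarrow> K \<subseteq> {1..n} \<and> minimum_maximal_K_antichain n K \<A>" for n \<A>
  \<comment> \<open>All minimum maximal antichains for the same \<open>n\<close> have equal
    cardinality, so the choice made by \<open>SOME\<close> does not affect the value. Where no such
    antichain is available, for instance when \<open>K\<close> is not inside \<open>{1..n}\<close>,
    the default is 0.\<close>
  define \<epsilon> where "\<epsilon> n = (if \<exists>\<A>. min_ac n \<A>
      then real (card (SOME \<A>. min_ac n \<A>)) / (real n)\<^sup>2 - \<kappa> else 0)" for n
  have "2 \<in> K" "3 \<in> K" using assms by auto
  have "l \<in> K" using assms \<open>2 \<in> K\<close> by (auto intro: Max_in)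
  have "l \<ge> 3" using assms \<open>3 \<in> K\<close> by simp
  have coeff: "(real_of_int \<lfloor>real l / 2\<rfloor> * real_of_int \<lceil>real l / 2\<rceil> + 1)
      / (4 * real_of_int \<lfloor>real l / 2\<rfloor> * real_of_int \<lceil>real l / 2\<rceil>) = \<kappa>"
  proof -
    have "\<lfloor>real l / 2\<rfloor> = int (l div 2)" by (metis floor_divide_of_nat_eq of_nat_numeral)
    moreover have "\<lceil>real l / 2\<rceil> = int ((l + 1) div 2)"
      by (cases "even l") (auto elim!: evenE oddE simp: ceiling_eq_iff)
    ultimately show ?thesis unfolding \<kappa>_def p_def by (simp add: mult.assoc)
  qed
  have eps: "real (card \<A>) = (\<kappa> + \<epsilon> n) * (real n)\<^sup>2" if "min_ac n \<A>" for n \<A>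
  proof -
    have "min_ac n (SOME \<A>. min_ac n \<A>)" using that by (rule someI)
    then have "card (SOME \<A>. min_ac n \<A>) = card \<A>"
      using that by (auto simp: min_ac_def minimum_maximal_K_antichain_def intro!: antisym)
    moreover have "n > 0" using that \<open>2 \<in> K\<close> by (auto simp: min_ac_def)
    ultimately show ?thesis using that by (auto simp: \<epsilon>_def)
  qed
  have "\<epsilon> \<longlonglongrightarrow> 0"
  proof (rule LIMSEQ_I)
    fix \<delta> :: real assume \<delta>: "\<delta> > 0"
    \<comment> \<open>The error is at most \<open>2 * \<eta>\<close> below and \<open>\<eta>\<close>
      above, hence the divisor 3. The constant \<open>c\<close> dominates the linear coefficients of
      both bounds; \<open>n > c / \<eta>\<close> absorbs the linear terms into
      \<open>\<eta> * n\<^sup>2\<close>, and \<open>n > c\<close> meets the size condition of the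
      lower bound.\<close>
    define \<eta> where "\<eta> = \<delta> / 3"
    define c where "c = real l ^ 3 / \<eta> + 1 + 2 * p"
    obtain n0 :: nat where n0: "real n0 > c / \<eta> + c" using reals_Archimedean2 by blast
    have "\<eta> > 0" using \<delta> by (simp add: \<eta>_def)
    have "p \<ge> 0" by (simp add: p_def)
    have "real l ^ 3 / \<eta> \<ge> 0" using \<open>\<eta> > 0\<close> by simp
    then have c: "c > real l ^ 3 / \<eta>" "c > 0" using \<open>p \<ge> 0\<close> by (auto simp: c_def)
    have "norm (\<epsilon> n - 0) < \<delta>" if n: "n \<ge> n0" for n
    proof (cases "\<exists>\<A>. min_ac n \<A>")
      case True
      then obtain \<A> where \<A>: "min_ac n \<A>" by blast
      have big: "real n > c / \<eta>" "real n > c" "real n > 0"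
        using n0 n c \<open>\<eta> > 0\<close> by (smt (verit) divide_pos_pos of_nat_le_iff)+
      have cn: "c * real n \<le> \<eta> * (real n)\<^sup>2"
        using big \<open>\<eta> > 0\<close> by (simp add: field_simps power2_eq_square)
      have max: "maximal_K_antichain n K \<A>"
        using \<A> by (simp add: min_ac_def minimum_maximal_K_antichain_def)
      have "real (card \<A>) \<ge> \<kappa> * (real n)\<^sup>2 - (real l ^ 3 / \<eta> + 1) * real n - \<eta> * (real n)\<^sup>2"
        unfolding \<kappa>_def p_def
        using assms \<open>2 \<in> K\<close> \<open>3 \<in> K\<close> max \<open>\<eta> > 0\<close> big c
        by (intro maximal_K_antichain_card_ge) auto
      moreover have "(real l ^ 3 / \<eta> + 1) * real n \<le> c * real n"
        using \<open>p \<ge> 0\<close> by (intro mult_right_mono) (auto simp: c_def)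
      ultimately have lower: "\<epsilon> n * (real n)\<^sup>2 \<ge> - (2 * \<eta>) * (real n)\<^sup>2"
        using cn eps[OF \<A>] by (simp add: algebra_simps)
      obtain \<B> where \<B>: "maximal_K_antichain n K \<B>"
        "real (card \<B>) \<le> \<kappa> * (real n)\<^sup>2 + 2 * p * real n"
        unfolding \<kappa>_def p_def
        using small_maximal_K_antichain[OF assms(2) \<open>2 \<in> K\<close> \<open>l \<in> K\<close> \<open>l \<ge> 3\<close>] by blast
      have "card \<A> \<le> card \<B>"
        using \<A> \<B> by (simp add: min_ac_def minimum_maximal_K_antichain_def)
      moreover have "2 * p * real n \<le> c * real n"
        using \<open>\<eta> > 0\<close> by (intro mult_right_mono) (auto simp: c_def)
      ultimately have upper: "\<epsilon> n * (real n)\<^sup>2 \<le> \<eta> * (real n)\<^sup>2"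
        using cn eps[OF \<A>] \<B> by (simp add: algebra_simps)
      have "- (2 * \<eta>) \<le> \<epsilon> n" "\<epsilon> n \<le> \<eta>"
        using lower upper big by (simp_all only: mult_le_cancel_right) auto
      then show ?thesis using \<delta> by (auto simp: \<eta>_def)
    qed (use \<delta> in \<open>simp add: \<epsilon>_def\<close>)
    then show "\<exists>n0. \<forall>n\<ge>n0. norm (\<epsilon> n - 0) < \<delta>" by blast
  qed
  moreover have "\<forall>n \<A>. K \<subseteq> {1..n} \<and> minimum_maximal_K_antichain n K \<A> \<longrightarrow>
      real (card \<A>) = (\<kappa> + \<epsilon> n) * (real n)\<^sup>2"
    using eps by (simp add: min_ac_def)
  ultimately show ?thesis unfolding coeff by blast
qed

end
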